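(* Let $$M = \begin{bmatrix} M_{11} & M_{12}\\ M_{12}^\top & M_{22}\end{bmatrix}\in\mathbb{S}^{n+m}\quad\text{and}\quad N = \begin{bmatrix} N_{11} & N_{12}\\ N_{12}^\top & N_{22}\end{bmatrix}\in\mathbb{S}^{n+m},$$ with $M_{11},N_{11}\in\mathbb{S}^n$, $M_{12},N_{12}\in\mathbb{R}^{n\times m}$, $M_{22},N_{22}\in\mathbb{S}^m$, be such that $N_{22}\preccurlyeq 0$, $N_{11}-N_{12}N_{22}^+N_{12}^\top = 0$, $M_{22}\preccurlyeq 0$ and $(I-N_{22}N_{22}^+)N_{12}^\top=0$. Consider the statements (NS1) there exists $\alpha\in\mathbb{R}$ such that $M+\alpha N\succcurlyeq 0$; (M2) $\begin{bmatrix} I\\ Z\end{bmatrix}^\top M\begin{bmatrix} I\\ Z\end{bmatrix}\succcurlyeq 0$ for all $Z\in\mathbb{R}^{m\times n}$ with $\begin{bmatrix} I\\ Z\end{bmatrix}^\top N\begin{bmatrix} I\\ Z\end{bmatrix}=0$; (NS3) $\ker N\cap \{\xi\in\mathbb{R}^{n+m}\mid \xi^\top M\xi=0\}\subset \ker M$. Then (NS1) holds if and only if (M2) and (NS3) both hold.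
   Context: $\mathbb{S}^k$ denotes the set of real symmetric $k\times k$ matrices. For symmetric $S$, $S\succcurlyeq 0$ (resp. $S\preccurlyeq 0$) means that $S$ is positive semi-definite (resp. negative semi-definite). $I$ is an identity matrix of appropriate dimension, and $A^+$ denotes the Moore-Penrose pseudoinverse of $A$. For a matrix $A\in\mathbb{R}^{p\times q}$, $\ker A=\{x\in\mathbb{R}^{q}\mid Ax=0\}$. The symbol $\subset$ denotes (not necessarily proper) set inclusion. *)

theory Defs
  imports "HOL-Analysis.Analysis"
begin

text \<open>A \<open>p \<times> q\<close> real matrix has type \<open>real ^ 'q ^ 'p\<close>; block matrices are indexed by sum types,
  so \<open>real ^ ('n + 'm)\<close> plays the role of \<open>(n + m)\<close>-dimensional space, with the
  \<open>Inl\<close> coordinates forming the first block.\<close>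

definition block_mat ::
    "real ^ 'a ^ 'p \<Rightarrow> real ^ 'b ^ 'p \<Rightarrow> real ^ 'a ^ 'q \<Rightarrow> real ^ 'b ^ 'q \<Rightarrow>
      real ^ ('a + 'b) ^ ('p + 'q)"
  where "block_mat A B C D =
    (\<chi> i j. case i of
        Inl k \<Rightarrow> (case j of Inl l \<Rightarrow> A $ k $ l | Inr l \<Rightarrow> B $ k $ l)
      | Inr k \<Rightarrow> (case j of Inl l \<Rightarrow> C $ k $ l | Inr l \<Rightarrow> D $ k $ l))"

definition stack_mat :: "real ^ 'a ^ 'p \<Rightarrow> real ^ 'a ^ 'q \<Rightarrow> real ^ 'a ^ ('p + 'q)"
  where "stack_mat A B = (\<chi> i. case i of Inl k \<Rightarrow> A $ k | Inr k \<Rightarrow> B $ k)"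

definition symmetric_mat :: "real ^ 'k ^ 'k \<Rightarrow> bool"
  where "symmetric_mat S \<longleftrightarrow> transpose S = S"

definition pos_semidef :: "real ^ 'k ^ 'k \<Rightarrow> bool"
  where "pos_semidef S \<longleftrightarrow> symmetric_mat S \<and> (\<forall>x. x \<bullet> (S *v x) \<ge> 0)"

definition neg_semidef :: "real ^ 'k ^ 'k \<Rightarrow> bool"
  where "neg_semidef S \<longleftrightarrow> symmetric_mat S \<and> (\<forall>x. x \<bullet> (S *v x) \<le> 0)"

definition mat_ker :: "real ^ 'q ^ 'p \<Rightarrow> (real ^ 'q) set"
  where "mat_ker A = {x. A *v x = 0}"

text \<open>The four Penrose equations; they determine \<open>X\<close> uniquely, and \<open>pinv A\<close> is the Moore-Penrose
  pseudoinverse, see \<open>is_pinv_pinv\<close> below.\<close>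

definition is_pinv :: "real ^ 'q ^ 'p \<Rightarrow> real ^ 'p ^ 'q \<Rightarrow> bool"
  where "is_pinv A X \<longleftrightarrow>
    A ** X ** A = A \<and> X ** A ** X = X \<and>
    transpose (A ** X) = A ** X \<and> transpose (X ** A) = X ** A"

definition pinv :: "real ^ 'q ^ 'p \<Rightarrow> real ^ 'p ^ 'q"
  where "pinv A = (THE X. is_pinv A X)"

lemma is_pinv_unique:
  assumes "is_pinv A X" "is_pinv A Y"
  shows "X = Y"
proof -
  have AXA: "A ** X ** A = A" and XAX: "X ** A ** X = X"
    and sAX: "transpose (A ** X) = A ** X" and sXA: "transpose (X ** A) = X ** A"
    and AYA: "A ** Y ** A = A" and YAY: "Y ** A ** Y = Y"
    and sAY: "transpose (A ** Y) = A ** Y" and sYA: "transpose (Y ** A) = Y ** A"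
    using assms by (auto simp: is_pinv_def)
  have "A ** X = transpose ((A ** Y) ** (A ** X))"
    by (metis AYA matrix_mul_assoc sAX)
  also have "\<dots> = (A ** X) ** (A ** Y)"
    by (simp add: matrix_transpose_mul[of "A ** Y" "A ** X"] sAX sAY)
  also have "\<dots> = A ** Y"
    by (metis AXA matrix_mul_assoc)
  finally have eA: "A ** X = A ** Y" .
  have "X ** A = transpose ((X ** A) ** (Y ** A))"
    by (metis AYA matrix_mul_assoc sXA)
  also have "\<dots> = (Y ** A) ** (X ** A)"
    by (simp add: matrix_transpose_mul[of "X ** A" "Y ** A"] sXA sYA)
  also have "\<dots> = Y ** A"
    by (metis AXA matrix_mul_assoc)
  finally have "X ** A = Y ** A" .
  with eA show ?thesis
    by (metis XAX YAY matrix_mul_assoc)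
qed

lemma orthogonal_projection_exists:
  fixes S :: "(real ^ 'k) set"
  assumes "subspace S"
  shows "\<exists>E :: real ^ 'k ^ 'k. transpose E = E \<and> (\<forall>x. E *v x \<in> S) \<and> (\<forall>x\<in>S. E *v x = x) \<and>
    (\<forall>x. x - E *v x \<in> orthogonal_comp S)"
proof -
  obtain B where B: "B \<subseteq> S" "pairwise orthogonal B" "\<And>x. x \<in> B \<Longrightarrow> norm x = 1"
      "independent B" "card B = dim S" "span B = S"
    using orthonormal_basis_subspace[OF assms] by metis
  have fin: "finite B" using B(4) independent_imp_finite by blast
  define e where "e x = (\<Sum>b\<in>B. (x \<bullet> b) *\<^sub>R b)" for x :: "real ^ 'k"
  have lin: "linear e"
    unfolding e_def
    by (rule linearI) (simp_all add: inner_left_distrib scaleR_left_distrib sum.distrib scaleR_sum_right)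
  have e_in: "e x \<in> S" for x
    unfolding e_def using B(1) assms by (auto intro!: subspace_sum subspace_scale)
  have e_b: "e x \<bullet> b = x \<bullet> b" if "b \<in> B" for x b
  proof -
    have "e x \<bullet> b = (\<Sum>c\<in>B. (x \<bullet> c) * (c \<bullet> b))"
      by (simp add: e_def inner_sum_left)
    also have "\<dots> = (\<Sum>c\<in>B. if c = b then x \<bullet> b else 0)"
    proof (rule sum.cong)
      fix c assume "c \<in> B"
      then show "(x \<bullet> c) * (c \<bullet> b) = (if c = b then x \<bullet> b else 0)"
        using B(2,3) that by (auto simp: pairwise_def orthogonal_def norm_eq_1)
    qed simp
    finally show ?thesis using fin that by simp
  qed
  have comp: "x - e x \<in> orthogonal_comp S" for x
  proof -
    have "orthogonal (x - e x) y" if "y \<in> S" for y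
    proof (rule orthogonal_to_span[of y B])
      show "y \<in> span B" using that B(6) by simp
    qed (simp add: orthogonal_def inner_diff_left e_b)
    then show ?thesis by (auto simp: orthogonal_comp_def orthogonal_commute)
  qed
  have e_id: "e x = x" if "x \<in> S" for x
  proof -
    have "x - e x \<in> S" using that e_in assms by (simp add: subspace_diff)
    then have "orthogonal (x - e x) (x - e x)"
      using comp[of x] by (auto simp: orthogonal_comp_def)
    then show ?thesis by (simp add: orthogonal_self)
  qed
  have sym: "x \<bullet> e y = e x \<bullet> y" for x y
    by (simp add: e_def inner_sum_left inner_sum_right inner_commute mult.commute)
  have E: "matrix e *v x = e x" for x by (simp add: lin)
  have "adjoint e = e" by (rule adjoint_unique) (simp add: sym)
  then have "transpose (matrix e) = matrix e"
    using matrix_adjoint[OF lin] by simp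
  then show ?thesis using e_in e_id comp E by metis
qed

lemma is_pinv_exists:
  fixes A :: "real ^ 'q ^ 'p"
  shows "\<exists>X. is_pinv A X"
proof -
  define K where "K = {x. A *v x = 0}"
  have subK: "subspace K"
    unfolding K_def by (auto simp: subspace_def matrix_vector_right_distrib matrix_vector_mult_scaleR)
  define R where "R = orthogonal_comp K"
  have subR: "subspace R" unfolding R_def by (rule subspace_orthogonal_comp)
  have RK: "orthogonal_comp R = K" unfolding R_def by (rule orthogonal_comp_self[OF subK])
  have subC: "subspace (range ((*v) A))"
    by (rule linear_subspace_image) simp_all
  obtain E where E: "transpose E = E" "\<And>x. E *v x \<in> R" "\<And>x. x \<in> R \<Longrightarrow> E *v x = x"
      "\<And>x. x - E *v x \<in> K"
    using orthogonal_projection_exists[OF subR] RK by metis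
  obtain F where F: "transpose F = F" "\<And>x. F *v x \<in> range ((*v) A)"
      "\<And>x. x \<in> range ((*v) A) \<Longrightarrow> F *v x = x"
    using orthogonal_projection_exists[OF subC] by metis
  have AE: "A *v (E *v x) = A *v x" for x
    using E(4)[of x] by (simp add: K_def matrix_vector_mult_diff_distrib)
  have inj: "inj_on ((*v) A) R"
  proof (rule inj_onI)
    fix x y assume xy: "x \<in> R" "y \<in> R" "A *v x = A *v y"
    then have "x - y \<in> K" by (simp add: K_def matrix_vector_mult_diff_distrib)
    moreover have "x - y \<in> R" using xy subR by (simp add: subspace_diff)
    ultimately have "orthogonal (x - y) (x - y)" by (auto simp: R_def orthogonal_comp_def)
    then show "x = y" by (simp add: orthogonal_self)
  qed
  obtain g where g: "range g \<subseteq> R" "linear g" "\<And>v. v \<in> R \<Longrightarrow> g (A *v v) = v"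
    using linear_exists_left_inverse_on[OF _ subR inj] by auto
  define X where "X = matrix g ** F"
  have X: "X *v y = g (F *v y)" for y
    by (simp add: X_def g(2) flip: matrix_vector_mul_assoc)
  have XA: "X *v (A *v x) = E *v x" for x
    using F(3)[of "A *v x"] g(3)[OF E(2), of x] by (simp add: X AE)
  have AX: "A *v (X *v y) = F *v y" for y
  proof -
    obtain x where x: "F *v y = A *v x" using F(2)[of y] by auto
    then have "X *v y = E *v x" using g(3)[OF E(2), of x] by (simp add: X AE)
    then show ?thesis by (simp add: AE x)
  qed
  have "X ** A = E" "A ** X = F"
    by (simp_all add: matrix_eq XA AX flip: matrix_vector_mul_assoc)
  moreover have "F ** A = A"
    by (simp add: matrix_eq F(3) flip: matrix_vector_mul_assoc)
  moreover have "E ** X = X"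
    using g(1) by (auto simp: matrix_eq X simp flip: matrix_vector_mul_assoc intro!: E(3))
  ultimately show ?thesis
    unfolding is_pinv_def using E(1) F(1) by metis
qed

lemma is_pinv_pinv: "is_pinv A (pinv A)"
  unfolding pinv_def
  by (rule theI') (use is_pinv_exists is_pinv_unique in blast)

end

theory Submission
  imports Defs
begin

text \<open>
  The hypotheses on \<open>N\<close> say that \<open>N12\<^sup>T = N22 W\<close> and \<open>N11 = N12 W\<close> for
  \<open>W = N22\<^sup>+ N12\<^sup>T\<close>. Hence the kernel of \<open>N\<close> contains the graph \<open>{(x, - W x)}\<close>
  (lemma \<open>pinv_graph_in_kernel\<close>). Subtracting the graph vector over \<open>x\<close> from \<open>(x, y)\<close> leaves
  \<open>(0, y + W x)\<close> without changing the quadratic form of \<open>N\<close>, so \<open>N22 \<preceq> 0\<close> gives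
  \<open>N \<preceq> 0\<close> (lemma \<open>neg_semidef_if_graph_in_kernel\<close>).

  A matrix \<open>Z\<close> with \<open>N [I; Z] = 0\<close> solves the constraint in (M2), and every vector of \<open>ker N\<close> with
  nonzero first block is \<open>[I; Z] x\<close> for some such \<open>Z\<close>: a rank-one correction of \<open>- W\<close>
  works (lemma \<open>kernel_vector_interpolation\<close>). So (M2) makes the quadratic form of \<open>M\<close> nonnegative
  on \<open>ker N\<close>, where vectors with zero first block are limits of the others
  (lemma \<open>nonneg_on_kernel\<close>).

  The step to (NS1) is a fact about arbitrary symmetric matrices: for \<open>N \<preceq> 0\<close>, if
  \<open>M\<close> is nonnegative on \<open>ker N\<close> and isotropic vectors of \<open>M\<close> in \<open>ker N\<close> lie in \<open>ker M\<close>, then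
  some \<open>M + \<alpha> N\<close> is positive semidefinite. This is a non-strict form of Finsler's lemma
  (lemma \<open>finsler_nonstrict\<close>), proved by splitting off \<open>ker N \<inter> ker M\<close> and using compactness of the
  unit sphere in its orthogonal complement. The converse direction is elementary: on \<open>ker N\<close> and on
  the range of an admissible \<open>[I; Z]\<close> the form of \<open>\<alpha> N\<close> vanishes, and an isotropic
  vector of a positive semidefinite matrix lies in its kernel.
\<close>

section \<open>Quadratic forms of symmetric matrices\<close>

lemma symmetric_mat_inner:
  assumes "symmetric_mat S"
  shows "x \<bullet> (S *v y) = (S *v x) \<bullet> y"
  using assms by (metis dot_lmul_matrix symmetric_mat_def transpose_matrix_vector)

lemma symmetric_mat_add_scaleR:
  assumes "symmetric_mat M" "symmetric_mat N"
  shows "symmetric_mat (M + a *\<^sub>R N)"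
  using assms by (simp add: symmetric_mat_def transpose_def vec_eq_iff)

lemma quadratic_form_add_kernel:
  assumes "symmetric_mat S" "S *v u = 0"
  shows "(u + v) \<bullet> (S *v (u + v)) = v \<bullet> (S *v v)"
  using assms by (simp add: matrix_vector_right_distrib inner_add_left symmetric_mat_inner)

lemma quadratic_form_pencil:
  fixes M N :: "real ^ 'k ^ 'k"
  shows "x \<bullet> ((M + a *\<^sub>R N) *v x) = x \<bullet> (M *v x) + a * (x \<bullet> (N *v x))"
  by (simp add: matrix_vector_mult_add_rdistrib scaleR_matrix_vector_assoc[symmetric] inner_add_right)

lemma quadratic_form_congruence:
  fixes A :: "real ^ 'k ^ 'k" and S :: "real ^ 'l ^ 'k"
  shows "x \<bullet> ((transpose S ** A ** S) *v x) = (S *v x) \<bullet> (A *v (S *v x))"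
  by (metis dot_lmul_matrix matrix_vector_mul_assoc transpose_matrix_vector transpose_transpose)

lemma symmetric_mat_congruence:
  fixes A :: "real ^ 'k ^ 'k" and S :: "real ^ 'l ^ 'k"
  assumes "symmetric_mat A"
  shows "symmetric_mat (transpose S ** A ** S)"
  using assms
  by (simp add: symmetric_mat_def matrix_transpose_mul matrix_mul_assoc)

lemma continuous_on_quadratic_form:
  fixes S :: "real ^ 'k ^ 'k"
  shows "continuous_on T (\<lambda>x. x \<bullet> (S *v x))"
  by (intro continuous_on_inner continuous_on_id linear_continuous_on) (simp add: linear_linear)

text \<open>Moving from an isotropic \<open>x\<close> a small step against \<open>S x\<close> would make the form negative,
  unless \<open>S x = 0\<close>.\<close>

lemma pos_semidef_isotropic_in_kernel:
  fixes S :: "real ^ 'k ^ 'k"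
  assumes S: "pos_semidef S" and x: "x \<bullet> (S *v x) = 0"
  shows "S *v x = 0"
proof -
  define z where "z = S *v x"
  define a where "a = z \<bullet> z"
  define c where "c = z \<bullet> (S *v z)"
  define t where "t = a / (c + 1)"
  have sym: "symmetric_mat S" and nonneg: "\<And>y. 0 \<le> y \<bullet> (S *v y)"
    using S by (auto simp: pos_semidef_def)
  have c: "c \<ge> 0" using nonneg by (simp add: c_def)
  have "x \<bullet> (S *v z) = a"
    by (simp add: symmetric_mat_inner[OF sym] z_def a_def)
  then have "(x - t *\<^sub>R z) \<bullet> (S *v (x - t *\<^sub>R z)) = t * (t * c) - 2 * t * a"
    using x
    by (simp add: matrix_vector_mult_diff_distrib matrix_vector_mult_scaleR inner_diff_left
        inner_diff_right c_def a_def z_def[symmetric] algebra_simps)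
  then have "0 \<le> t * (t * c) - 2 * t * a" using nonneg by metis
  moreover have "t * c \<le> a" and "0 \<le> t"
    using c by (auto simp: t_def a_def field_simps)
  then have "t * (t * c) \<le> t * a" by (rule mult_left_mono)
  ultimately have "t * a \<le> 0" by simp
  then have "a * a \<le> 0"
    using c by (simp add: t_def divide_le_0_iff)
  then have "a = 0" by (auto simp: mult_le_0_iff)
  then show ?thesis by (simp add: a_def z_def)
qed

lemma neg_semidef_isotropic_in_kernel:
  fixes S :: "real ^ 'k ^ 'k"
  assumes S: "neg_semidef S" and x: "x \<bullet> (S *v x) = 0"
  shows "S *v x = 0"
proof -
  have minus: "(- S) *v y = - (S *v y)" for y
    by (simp add: vec_eq_iff matrix_vector_mult_def sum_negf)
  have "pos_semidef (- S)"
    using S by (auto simp: pos_semidef_def neg_semidef_def symmetric_mat_def minus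
        transpose_def vec_eq_iff)
  then show ?thesis
    using pos_semidef_isotropic_in_kernel[of "- S" x] x by (simp add: minus)
qed

section \<open>A non-strict Finsler lemma\<close>

text \<open>On a compact set, where \<open>f\<close> is not positive the strictly positive \<open>g\<close> is bounded away
  from \<open>0\<close>, so a large multiple of it outweighs the lower bound of \<open>f\<close>; elsewhere \<open>g\<close> does no harm.\<close>

lemma compact_compensation:
  fixes f g :: "'a::metric_space \<Rightarrow> real"
  assumes S: "compact S" and f: "continuous_on S f" and g: "continuous_on S g"
    and g0: "\<And>x. x \<in> S \<Longrightarrow> 0 \<le> g x"
    and pos: "\<And>x. x \<in> S \<Longrightarrow> f x \<le> 0 \<Longrightarrow> 0 < g x"
  shows "\<exists>b. \<forall>x\<in>S. 0 \<le> f x + b * g x"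
proof -
  define C where "C = S \<inter> f -` {..0}"
  have "closedin (top_of_set S) C"
    unfolding C_def by (rule continuous_closedin_preimage[OF f]) simp
  then have C: "compact C" using S closedin_compact by blast
  have sub: "C \<subseteq> S" by (auto simp: C_def)
  show ?thesis
  proof (cases "C = {}")
    case True
    then have "\<forall>x\<in>S. 0 \<le> f x + 0 * g x" by (force simp: C_def)
    then show ?thesis by blast
  next
    case False
    obtain p where p: "p \<in> C" "\<And>x. x \<in> C \<Longrightarrow> g p \<le> g x"
      using continuous_attains_inf[OF C False continuous_on_subset[OF g sub]] by blast
    obtain q where q: "q \<in> C" "\<And>x. x \<in> C \<Longrightarrow> f q \<le> f x"
      using continuous_attains_inf[OF C False continuous_on_subset[OF f sub]] by blast
    have gp: "0 < g p" and fq: "f q \<le> 0" using p(1) q(1) pos by (auto simp: C_def)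
    define b where "b = - f q / g p"
    have b: "0 \<le> b" using gp fq by (simp add: b_def divide_nonpos_pos)
    have "0 \<le> f x + b * g x" if x: "x \<in> S" for x
    proof (cases "f x \<le> 0")
      case True
      then have xC: "x \<in> C" using x by (simp add: C_def)
      have "b * g p \<le> b * g x" using p(2)[OF xC] b by (rule mult_left_mono)
      moreover have "b * g p = - f q" using gp by (simp add: b_def)
      ultimately show ?thesis using q(2)[OF xC] by simp
    next
      case False
      then show ?thesis using b g0[OF x] by simp
    qed
    then show ?thesis by blast
  qed
qed

text \<open>Both forms ignore components in \<open>K = ker N \<inter> ker M\<close>. On the unit sphere of the orthogonal
  complement of \<open>K\<close>, a point where the form of \<open>M\<close> is not positive cannot lie in \<open>ker N\<close>: there it would
  be isotropic for \<open>M\<close>, hence in \<open>K\<close>. So the form of \<open>N\<close> is negative at such points, and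
  compactness provides the multiple.\<close>

lemma finsler_nonstrict:
  fixes M N :: "real ^ 'k ^ 'k"
  assumes M: "symmetric_mat M" and N: "neg_semidef N"
    and nonneg: "\<And>x. N *v x = 0 \<Longrightarrow> 0 \<le> x \<bullet> (M *v x)"
    and ker: "mat_ker N \<inter> {x. x \<bullet> (M *v x) = 0} \<subseteq> mat_ker M"
  shows "\<exists>\<alpha>. pos_semidef (M + \<alpha> *\<^sub>R N)"
proof -
  have symN: "symmetric_mat N" and N0: "\<And>x. x \<bullet> (N *v x) \<le> 0"
    using N by (auto simp: neg_semidef_def)
  define K where "K = mat_ker N \<inter> mat_ker M"
  define S where "S = orthogonal_comp K \<inter> sphere 0 1"
  have subK: "subspace K"
    by (auto simp: K_def mat_ker_def subspace_def matrix_vector_right_distrib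
        matrix_vector_mult_scaleR)
  have "compact S"
    unfolding S_def
    by (intro closed_Int_compact closed_subspace subspace_orthogonal_comp compact_sphere)
  moreover have "0 < - (x \<bullet> (N *v x))" if x: "x \<in> S" "x \<bullet> (M *v x) \<le> 0" for x
  proof (rule ccontr)
    assume "\<not> ?thesis"
    then have "x \<bullet> (N *v x) = 0" using N0[of x] by simp
    then have Nx: "N *v x = 0" by (rule neg_semidef_isotropic_in_kernel[OF N])
    then have "x \<in> K" using x(2) nonneg[OF Nx] ker by (auto simp: K_def mat_ker_def)
    then have "orthogonal x x" using x(1) by (auto simp: S_def orthogonal_comp_def)
    then show False using x(1) by (simp add: S_def orthogonal_self)
  qed
  ultimately have "\<exists>b. \<forall>x\<in>S. 0 \<le> x \<bullet> (M *v x) + b * - (x \<bullet> (N *v x))"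
    using N0
    by (intro compact_compensation continuous_on_quadratic_form continuous_on_minus) auto
  then obtain b where
    b: "\<And>x. x \<in> S \<Longrightarrow> 0 \<le> x \<bullet> (M *v x) + b * - (x \<bullet> (N *v x))"
    by blast
  define P where "P = M + (- b) *\<^sub>R N"
  have symP: "symmetric_mat P"
    unfolding P_def by (rule symmetric_mat_add_scaleR[OF M symN])
  have "0 \<le> x \<bullet> (P *v x)" for x
  proof -
    obtain u v where u: "u \<in> K" and v: "v \<in> orthogonal_comp K" and x: "x = u + v"
      using subspace_sum_orthogonal_comp[OF subK] by (metis UNIV_I set_plus_elim)
    have "P *v u = 0"
      using u by (simp add: P_def K_def mat_ker_def matrix_vector_mult_diff_rdistrib
          scaleR_matrix_vector_assoc[symmetric])
    then have eq: "x \<bullet> (P *v x) = v \<bullet> (P *v v)"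
      unfolding x by (rule quadratic_form_add_kernel[OF symP])
    show ?thesis
    proof (cases "v = 0")
      case False
      define w where "w = (1 / norm v) *\<^sub>R v"
      have "w \<in> S"
        using False v subspace_orthogonal_comp[of K]
        by (auto simp: S_def w_def intro: subspace_scale)
      then have "0 \<le> w \<bullet> (P *v w)"
        unfolding P_def quadratic_form_pencil using b by simp
      moreover have "v = norm v *\<^sub>R w" using False by (simp add: w_def)
      then have "v \<bullet> (P *v v) = norm v * (norm v * (w \<bullet> (P *v w)))"
        by (metis inner_scaleR_left inner_scaleR_right matrix_vector_mult_scaleR)
      ultimately show ?thesis by (simp add: eq)
    qed (simp add: eq)
  qed
  then show ?thesis using symP unfolding P_def pos_semidef_def by blast
qed

section \<open>Block vectors and the graph in the kernel\<close>

definition stack_vec :: "real ^ 'a \<Rightarrow> real ^ 'b \<Rightarrow> real ^ ('a + 'b)"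
  where "stack_vec x y = (\<chi> i. case i of Inl k \<Rightarrow> x $ k | Inr k \<Rightarrow> y $ k)"

lemma stack_vec_cases:
  obtains x y where "z = stack_vec x y"
proof
  show "z = stack_vec (\<chi> i. z $ Inl i) (\<chi> i. z $ Inr i)"
    by (simp add: stack_vec_def vec_eq_iff split: sum.split)
qed

lemma stack_vec_add: "stack_vec x y + stack_vec x' y' = stack_vec (x + x') (y + y')"
  by (simp add: stack_vec_def vec_eq_iff split: sum.split)

lemma stack_vec_scaleR: "c *\<^sub>R stack_vec x y = stack_vec (c *\<^sub>R x) (c *\<^sub>R y)"
  by (simp add: stack_vec_def vec_eq_iff split: sum.split)

lemma stack_vec_0: "stack_vec 0 0 = 0"
  by (simp add: stack_vec_def vec_eq_iff split: sum.split)

lemma sum_UNIV_Plus: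
  fixes f :: "'a::finite + 'b::finite \<Rightarrow> real"
  shows "sum f UNIV = (\<Sum>k\<in>UNIV. f (Inl k)) + (\<Sum>k\<in>UNIV. f (Inr k))"
  by (subst UNIV_Plus_UNIV[symmetric], subst sum.Plus) auto

lemma stack_vec_inner: "stack_vec x y \<bullet> stack_vec x' y' = x \<bullet> x' + y \<bullet> y'"
  by (simp add: stack_vec_def inner_vec_def sum_UNIV_Plus)

lemma stack_mat_mult_vec: "stack_mat A B *v x = stack_vec (A *v x) (B *v x)"
  by (simp add: stack_mat_def stack_vec_def matrix_vector_mult_def vec_eq_iff split: sum.split)

lemma block_mat_mult_stack_vec:
  "block_mat A B C D *v stack_vec x y = stack_vec (A *v x + B *v y) (C *v x + D *v y)"
  by (simp add: block_mat_def stack_vec_def matrix_vector_mult_def vec_eq_iff sum_UNIV_Plus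
      split: sum.split)

lemma symmetric_block_mat:
  assumes "symmetric_mat A" "symmetric_mat D"
  shows "symmetric_mat (block_mat A B (transpose B) D)"
  using assms
  by (auto simp: symmetric_mat_def block_mat_def transpose_def vec_eq_iff split: sum.split)

lemma pinv_graph_in_kernel:
  fixes A :: "real ^ 'n ^ 'n" and B :: "real ^ 'm ^ 'n" and D :: "real ^ 'm ^ 'm"
  assumes schur: "A - B ** pinv D ** transpose B = 0"
    and range: "(mat 1 - D ** pinv D) ** transpose B = 0"
  shows "block_mat A B (transpose B) D *v stack_vec x (- (pinv D ** transpose B *v x)) = 0"
proof -
  have minus: "E *v (- y) = - (E *v y)" for E :: "real ^ 'm ^ 'p" and y
    by (simp add: vec_eq_iff matrix_vector_mult_def sum_negf)
  have "A *v x = B *v (pinv D ** transpose B *v x)"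
    using schur by (simp add: matrix_vector_mul_assoc matrix_mul_assoc)
  moreover have "(mat 1 - D ** pinv D) *v (transpose B *v x) = 0"
    using range by (simp add: matrix_vector_mul_assoc del: transpose_matrix_vector)
  then have "transpose B *v x = D *v (pinv D ** transpose B *v x)"
    by (simp add: matrix_vector_mult_diff_rdistrib del: transpose_matrix_vector
        flip: matrix_vector_mul_assoc)
  ultimately show ?thesis by (simp add: block_mat_mult_stack_vec minus stack_vec_0)
qed

text \<open>Subtracting the graph vector over its first block reduces any vector to one supported on the
  second block, where the form is that of \<open>D\<close>.\<close>

lemma neg_semidef_if_graph_in_kernel:
  fixes A :: "real ^ 'n ^ 'n" and B :: "real ^ 'm ^ 'n" and D :: "real ^ 'm ^ 'm"
    and G :: "real ^ 'n \<Rightarrow> real ^ 'm"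
  assumes sym: "symmetric_mat (block_mat A B C D)" and D: "neg_semidef D"
    and graph: "\<And>x. block_mat A B C D *v stack_vec x (G x) = 0"
  shows "neg_semidef (block_mat A B C D)"
proof -
  have "z \<bullet> (block_mat A B C D *v z) \<le> 0" for z
  proof -
    obtain x y where z: "z = stack_vec x y" by (rule stack_vec_cases)
    then have "z = stack_vec x (G x) + stack_vec 0 (y - G x)" by (simp add: stack_vec_add)
    then have "z \<bullet> (block_mat A B C D *v z)
        = stack_vec 0 (y - G x) \<bullet> (block_mat A B C D *v stack_vec 0 (y - G x))"
      using quadratic_form_add_kernel[OF sym graph] by simp
    also have "\<dots> = (y - G x) \<bullet> (D *v (y - G x))"
      by (simp add: block_mat_mult_stack_vec stack_vec_inner)
    also have "\<dots> \<le> 0" using D by (simp add: neg_semidef_def)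
    finally show ?thesis .
  qed
  then show ?thesis using sym by (simp add: neg_semidef_def)
qed

section \<open>Nonnegativity on the kernel\<close>

text \<open>The graph map is corrected by a map of rank one that sends \<open>x\<close> to \<open>y - G x\<close>. The correction
  adds multiples of \<open>(0, y - G x)\<close>, the difference of two kernel vectors, so the columns
  remain in the kernel.\<close>

lemma kernel_vector_interpolation:
  fixes N :: "real ^ ('n::finite + 'm::finite) ^ 'k" and G :: "real ^ 'n \<Rightarrow> real ^ 'm"
  assumes G: "linear G" and graph: "\<And>w. N *v stack_vec w (G w) = 0"
    and xy: "N *v stack_vec x y = 0" and x: "x \<noteq> 0"
  shows "\<exists>Z. N ** stack_mat (mat 1) Z = 0 \<and> stack_mat (mat 1) Z *v x = stack_vec x y"
proof -
  define f where "f w = G w + ((x \<bullet> w) / (x \<bullet> x)) *\<^sub>R (y - G x)" for w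
  have lin: "linear f"
    unfolding f_def
    by (intro linear_compose_add[OF G] linearI)
      (simp_all add: inner_add_right add_divide_distrib scaleR_left_distrib)
  have Z: "stack_mat (mat 1) (matrix f) *v w = stack_vec w (f w)" for w
    by (simp add: stack_mat_mult_vec lin)
  have "stack_vec x y = stack_vec x (G x) + stack_vec 0 (y - G x)"
    by (simp add: stack_vec_add)
  then have corr: "N *v stack_vec 0 (y - G x) = 0"
    using graph[of x] xy by (simp add: matrix_vector_right_distrib)
  have "stack_vec w (f w) = stack_vec w (G w) + ((x \<bullet> w) / (x \<bullet> x)) *\<^sub>R stack_vec 0 (y - G x)" for w
    by (simp add: f_def stack_vec_add stack_vec_scaleR)
  then have "N *v stack_vec w (f w) = 0" for w
    using graph corr by (simp add: matrix_vector_right_distrib matrix_vector_mult_scaleR)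
  then have "N ** stack_mat (mat 1) (matrix f) = 0"
    by (simp add: matrix_eq Z flip: matrix_vector_mul_assoc)
  moreover have "f x = y" using x by (simp add: f_def)
  ultimately show ?thesis using Z by metis
qed

text \<open>Interpolation settles the kernel vectors with nonzero first block. Any other kernel vector is
  approached along a graph vector with nonzero first block, and the form is continuous.\<close>

lemma nonneg_on_kernel:
  fixes M :: "real ^ ('n::finite + 'm::finite) ^ ('n + 'm)" and N :: "real ^ ('n + 'm) ^ 'k"
    and G :: "real ^ 'n \<Rightarrow> real ^ 'm"
  assumes G: "linear G" and graph: "\<And>w. N *v stack_vec w (G w) = 0"
    and M: "\<And>Z x. N ** stack_mat (mat 1) Z = 0 \<Longrightarrow>
      0 \<le> (stack_mat (mat 1) Z *v x) \<bullet> (M *v (stack_mat (mat 1) Z *v x))"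
    and z: "N *v z = 0"
  shows "0 \<le> z \<bullet> (M *v z)"
proof -
  have nonzero: "0 \<le> stack_vec x y \<bullet> (M *v stack_vec x y)"
    if "x \<noteq> 0" "N *v stack_vec x y = 0" for x y
    using kernel_vector_interpolation[OF G graph that(2,1)] M by metis
  obtain x y where xy: "z = stack_vec x y" by (rule stack_vec_cases)
  show ?thesis
  proof (cases "x = 0")
    case False
    then show ?thesis using nonzero z xy by simp
  next
    case True
    define e :: "real ^ 'n" where "e = 1"
    have e: "e \<noteq> 0" by (simp add: e_def)
    define p where "p t = z + t *\<^sub>R stack_vec e (G e)" for t :: real
    have p: "p t = stack_vec (t *\<^sub>R e) (y + t *\<^sub>R G e)" for t
      by (simp add: p_def xy True stack_vec_add stack_vec_scaleR)
    have "N *v p t = 0" for t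
      using z graph[of e] by (simp add: p_def matrix_vector_right_distrib matrix_vector_mult_scaleR)
    then have pos: "0 \<le> p t \<bullet> (M *v p t)" if "t \<noteq> 0" for t
      using nonzero[of "t *\<^sub>R e" "y + t *\<^sub>R G e"] that e unfolding p by simp
    have "continuous_on UNIV (\<lambda>t. p t \<bullet> (M *v p t))"
      unfolding p_def
      by (rule continuous_on_compose2[OF continuous_on_quadratic_form[of UNIV M]])
        (auto intro!: continuous_intros)
    then have "((\<lambda>t. p t \<bullet> (M *v p t)) \<longlongrightarrow> p 0 \<bullet> (M *v p 0)) (at 0)"
      by (simp add: continuous_on_def)
    moreover have "\<forall>\<^sub>F t in at 0. 0 \<le> p t \<bullet> (M *v p t)"
      using pos by (auto simp: eventually_at_filter)
    ultimately have "0 \<le> p 0 \<bullet> (M *v p 0)"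
      by (rule tendsto_lowerbound) simp
    then show ?thesis by (simp add: p_def)
  qed
qed

section \<open>The matrix inequality\<close>

theorem lemma5:
  fixes M N :: "real ^ ('n::finite + 'm::finite) ^ ('n + 'm)"
    and M11 N11 :: "real ^ 'n ^ 'n"
    and M12 N12 :: "real ^ 'm ^ 'n"
    and M22 N22 :: "real ^ 'm ^ 'm"
  assumes "M = block_mat M11 M12 (transpose M12) M22"
    and "N = block_mat N11 N12 (transpose N12) N22"
    and "symmetric_mat M11" and "symmetric_mat M22"
    and "symmetric_mat N11" and "symmetric_mat N22"
    and "neg_semidef N22"
    and "N11 - N12 ** pinv N22 ** transpose N12 = 0"
    and "neg_semidef M22"
    and "(mat 1 - N22 ** pinv N22) ** transpose N12 = 0"
  shows "(\<exists>\<alpha>::real. pos_semidef (M + \<alpha> *\<^sub>R N)) \<longleftrightarrow>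
    (\<forall>Z :: real ^ 'n ^ 'm.
        transpose (stack_mat (mat 1) Z) ** N ** stack_mat (mat 1) Z = 0 \<longrightarrow>
        pos_semidef (transpose (stack_mat (mat 1) Z) ** M ** stack_mat (mat 1) Z)) \<and>
    mat_ker N \<inter> {\<xi>. \<xi> \<bullet> (M *v \<xi>) = 0} \<subseteq> mat_ker M"
    (is "?NS1 \<longleftrightarrow> ?M2 \<and> ?NS3")
proof -
  have symM: "symmetric_mat M" and symN: "symmetric_mat N"
    using assms(1-6) symmetric_block_mat by blast+
  define G where "G w = - (pinv N22 ** transpose N12 *v w)" for w
  have G: "linear G"
    unfolding G_def by (intro linear_compose_neg matrix_vector_mul_linear)
  have graph: "N *v stack_vec w (G w) = 0" for w
    unfolding G_def assms(2) by (rule pinv_graph_in_kernel[OF assms(8,10)])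
  have N: "neg_semidef N"
    using neg_semidef_if_graph_in_kernel[OF _ assms(7)] symN graph unfolding assms(2) by blast
  show ?thesis
  proof
    assume ?NS1
    then obtain \<alpha> where P: "pos_semidef (M + \<alpha> *\<^sub>R N)" by blast
    then have pencil: "0 \<le> x \<bullet> (M *v x) + \<alpha> * (x \<bullet> (N *v x))" for x
      by (simp add: pos_semidef_def flip: quadratic_form_pencil)
    have ?M2
    proof (intro allI impI)
      fix Z :: "real ^ 'n ^ 'm"
      let ?S = "stack_mat (mat 1) Z :: real ^ 'n ^ ('n + 'm)"
      assume "transpose ?S ** N ** ?S = 0"
      then have "(?S *v x) \<bullet> (N *v (?S *v x)) = 0" for x
        by (simp flip: quadratic_form_congruence)
      then have "0 \<le> x \<bullet> ((transpose ?S ** M ** ?S) *v x)" for x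
        using pencil[of "?S *v x"] by (simp add: quadratic_form_congruence)
      then show "pos_semidef (transpose ?S ** M ** ?S)"
        using symmetric_mat_congruence[OF symM] by (simp add: pos_semidef_def)
    qed
    moreover have ?NS3
    proof
      fix x assume "x \<in> mat_ker N \<inter> {\<xi>. \<xi> \<bullet> (M *v \<xi>) = 0}"
      then have x: "N *v x = 0" "x \<bullet> (M *v x) = 0" by (auto simp: mat_ker_def)
      then have "(M + \<alpha> *\<^sub>R N) *v x = 0"
        by (intro pos_semidef_isotropic_in_kernel[OF P]) (simp add: quadratic_form_pencil)
      then show "x \<in> mat_ker M"
        using x(1) by (simp add: mat_ker_def matrix_vector_mult_add_rdistrib
            scaleR_matrix_vector_assoc[symmetric])
    qed
    ultimately show "?M2 \<and> ?NS3" ..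
  next
    assume R: "?M2 \<and> ?NS3"
    have "0 \<le> (stack_mat (mat 1) Z *v x) \<bullet> (M *v (stack_mat (mat 1) Z *v x))"
      if "N ** stack_mat (mat 1) Z = 0" for Z :: "real ^ 'n ^ 'm" and x
    proof -
      have "transpose (stack_mat (mat 1) Z) ** N ** stack_mat (mat 1) Z = 0"
        using that by (simp flip: matrix_mul_assoc)
      then show ?thesis
        using R by (simp add: pos_semidef_def flip: quadratic_form_congruence)
    qed
    then have "0 \<le> x \<bullet> (M *v x)" if "N *v x = 0" for x
      using nonneg_on_kernel[OF G graph _ that] by blast
    then show ?NS1 using finsler_nonstrict[OF symM N] R by blast
  qed
qed

end
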